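(* Let $(X,+,\cdot)$ be a nonempty compact Hausdorff left topological left semiring. Then $X$ has a common idempotent, i.e. there is $e\in X$ with $e+e=e$ and $e\cdot e=e$. Consequently, if $X$ is moreover minimal compact, then $X$ consists of a unique element.
   Context: A left semiring is a set $X$ with two binary operations $+$ and $\cdot$ such that both operations are associative (neither is assumed commutative, and no neutral elements are assumed) and $\cdot$ is left distributive with respect to $+$: $x\cdot(y+z)=x\cdot y+x\cdot z$ for all $x,y,z\in X$ (right distributivity is not assumed). It is left topological if $X$ carries a topology such that for every fixed $a\in X$ the left translations $x\mapsto a+x$ and $x\mapsto a\cdot x$ are continuous (right translations need not be continuous). It is compact Hausdorff if its topology is. A subalgebra is a nonempty subset closed under both operations. $X$ is minimal compact if it is compact and includes no proper compact subalgebra. *)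

theory Defs
  imports "HOL-Analysis.Analysis"
begin

locale left_semiring =
  fixes X :: "'a set"
    and add :: "'a \<Rightarrow> 'a \<Rightarrow> 'a"
    and mul :: "'a \<Rightarrow> 'a \<Rightarrow> 'a"
  assumes add_closed: "\<lbrakk>x \<in> X; y \<in> X\<rbrakk> \<Longrightarrow> add x y \<in> X"
    and mul_closed: "\<lbrakk>x \<in> X; y \<in> X\<rbrakk> \<Longrightarrow> mul x y \<in> X"
    and add_assoc: "\<lbrakk>x \<in> X; y \<in> X; z \<in> X\<rbrakk> \<Longrightarrow> add (add x y) z = add x (add y z)"
    and mul_assoc: "\<lbrakk>x \<in> X; y \<in> X; z \<in> X\<rbrakk> \<Longrightarrow> mul (mul x y) z = mul x (mul y z)"
    and left_distrib:
      "\<lbrakk>x \<in> X; y \<in> X; z \<in> X\<rbrakk> \<Longrightarrow> mul x (add y z) = add (mul x y) (mul x z)"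

text \<open>The underlying set is the carrier \<open>topspace T\<close> of the topology.\<close>

locale left_topological_left_semiring = left_semiring "topspace T" add mul
  for T :: "'a topology"
    and add :: "'a \<Rightarrow> 'a \<Rightarrow> 'a"
    and mul :: "'a \<Rightarrow> 'a \<Rightarrow> 'a" +
  assumes continuous_add_left: "a \<in> topspace T \<Longrightarrow> continuous_map T T (\<lambda>x. add a x)"
    and continuous_mul_left: "a \<in> topspace T \<Longrightarrow> continuous_map T T (\<lambda>x. mul a x)"

definition subalgebra :: "'a set \<Rightarrow> ('a \<Rightarrow> 'a \<Rightarrow> 'a) \<Rightarrow> ('a \<Rightarrow> 'a \<Rightarrow> 'a) \<Rightarrow> 'a set \<Rightarrow> bool" where
  "subalgebra X add mul S \<longleftrightarrow>
     S \<subseteq> X \<and> S \<noteq> {} \<and> (\<forall>x\<in>S. \<forall>y\<in>S. add x y \<in> S \<and> mul x y \<in> S)"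

definition minimal_compact :: "'a topology \<Rightarrow> ('a \<Rightarrow> 'a \<Rightarrow> 'a) \<Rightarrow> ('a \<Rightarrow> 'a \<Rightarrow> 'a) \<Rightarrow> bool" where
  "minimal_compact T add mul \<longleftrightarrow>
     compact_space T \<and>
     \<not> (\<exists>S. subalgebra (topspace T) add mul S \<and> S \<noteq> topspace T \<and> compactin T S)"

end

theory Submission
  imports Defs
begin

text \<open>
  The argument iterates the one behind the Ellis--Numakura lemma. Compactness and Zorn's lemma give
  a minimal closed subalgebra \<open>M\<close>. If a continuous self-map \<open>h\<close> of \<open>M\<close> has a subalgebra as image,
  then minimality makes it onto; and if the fibre of \<open>h\<close> over some \<open>c\<close> is closed under the
  operations, then this fibre, being nonempty, is all of \<open>M\<close>. In particular \<open>h c = c\<close>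
  (\<open>minimal_fixes\<close>).

  For a single operation, the left translation \<open>h = f a\<close> with \<open>c = a\<close> satisfies both conditions by
  associativity, so that every compact left topological semigroup has an idempotent
  (\<open>ellis_idempotent\<close>). For a left semiring, let \<open>M\<close> be minimal with respect to both operations and
  take \<open>h = mul a\<close>, \<open>c = a\<close>, where \<open>a\<close> is an additive idempotent of \<open>M\<close>. The image \<open>a \<cdot> M\<close> is closed
  under addition by left distributivity. The fibre of those \<open>x\<close> with \<open>a \<cdot> x = a\<close> is closed under
  addition because \<open>a \<cdot> (x + y) = a \<cdot> x + a \<cdot> y = a + a = a\<close>; this is where additive idempotence
  enters. Hence \<open>a \<cdot> a = a\<close>, and \<open>a\<close> is idempotent for both operations.

  A common idempotent \<open>e\<close> forms a compact subalgebra \<open>{e}\<close>, so a minimal compact algebra is just \<open>{e}\<close>.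
\<close>

definition minimal_closed_subalgebra ::
    "'a topology \<Rightarrow> ('a \<Rightarrow> 'a \<Rightarrow> 'a) \<Rightarrow> ('a \<Rightarrow> 'a \<Rightarrow> 'a) \<Rightarrow> 'a set \<Rightarrow> bool" where
  "minimal_closed_subalgebra T f g M \<longleftrightarrow>
     closedin T M \<and> subalgebra (topspace T) f g M \<and>
     (\<forall>N. N \<subseteq> M \<and> closedin T N \<and> subalgebra (topspace T) f g N \<longrightarrow> N = M)"

text \<open>
  Compactness keeps the intersection of a chain of nonempty closed sets nonempty, which is what
  Zorn's lemma requires for the reverse inclusion.
\<close>

lemma exists_minimal_closed_subalgebra:
  assumes "compact_space T" "closedin T S" "subalgebra (topspace T) f g S"
  obtains M where "M \<subseteq> S" "minimal_closed_subalgebra T f g M"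
proof -
  define A where "A = {N. N \<subseteq> S \<and> closedin T N \<and> subalgebra (topspace T) f g N}"
  have "\<exists>M\<in>A. \<forall>N\<in>A. M \<supseteq> N \<longrightarrow> N = M"
  proof (rule predicate_Zorn)
    show "partial_order_on A (relation_of (\<supseteq>) A)"
      by (rule partial_order_on_relation_ofI) auto
  next
    fix C assume "C \<in> Chains (relation_of (\<supseteq>) A)"
    then have CA: "C \<subseteq> A" and chain: "\<And>U V. \<lbrakk>U \<in> C; V \<in> C\<rbrakk> \<Longrightarrow> U \<subseteq> V \<or> V \<subseteq> U"
      by (auto simp: Chains_def relation_of_def)
    have memA: "N \<subseteq> S \<and> closedin T N \<and> N \<noteq> {} \<and> (\<forall>x\<in>N. \<forall>y\<in>N. f x y \<in> N \<and> g x y \<in> N)"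
      if "N \<in> C" for N
      using subsetD[OF CA that] by (simp add: A_def subalgebra_def)
    show "\<exists>L\<in>A. \<forall>N\<in>C. N \<supseteq> L"
    proof (cases "C = {}")
      case True
      then show ?thesis
        using assms by (auto simp: A_def)
    next
      case False
      have "\<Inter>F \<noteq> {}" if "finite F" "F \<subseteq> C" for F
      proof (cases "F = {}")
        case False
        have "subset.chain A F"
          using that CA chain unfolding subset_chain_def by blast
        then have "\<Inter>F \<in> F"
          using that False by (metis Inter_in_chain)
        then show ?thesis
          using that memA by blast
      qed auto
      moreover have "\<forall>N\<in>C. closedin T N"
        using memA by blast
      ultimately have "\<Inter>C \<noteq> {}" and "closedin T (\<Inter>C)"
        using assms(1) False by (auto simp: compact_space_fip intro!: closedin_Inter)
      moreover have "\<Inter>C \<subseteq> S"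
        using False memA by blast
      moreover have "\<forall>x\<in>\<Inter>C. \<forall>y\<in>\<Inter>C. f x y \<in> \<Inter>C \<and> g x y \<in> \<Inter>C"
        using memA by blast
      ultimately have "\<Inter>C \<in> A"
        using closedin_subset[of T "\<Inter>C"] by (simp add: A_def subalgebra_def)
      then show ?thesis
        by blast
    qed
  qed
  then obtain M where "M \<in> A" "\<forall>N\<in>A. N \<subseteq> M \<longrightarrow> N = M"
    by blast
  then have "M \<subseteq> S" "minimal_closed_subalgebra T f g M"
    by (auto simp: A_def minimal_closed_subalgebra_def)
  then show thesis
    by (rule that)
qed

text \<open>
  Minimality is used twice: the image of \<open>h\<close> is a closed subalgebra, so \<open>h\<close> is onto and its fibre
  over \<open>c\<close> is nonempty; this fibre is then a closed subalgebra as well, hence contains \<open>c\<close>.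
\<close>

lemma minimal_fixes:
  assumes T: "compact_space T" "Hausdorff_space T"
    and M: "minimal_closed_subalgebra T f g M"
    and h: "continuous_map T T h" "h ` M \<subseteq> M"
    and image: "\<And>x y. \<lbrakk>x \<in> M; y \<in> M\<rbrakk> \<Longrightarrow> f (h x) (h y) \<in> h ` M \<and> g (h x) (h y) \<in> h ` M"
    and c: "c \<in> M"
    and fibre: "\<And>x y. \<lbrakk>x \<in> M; y \<in> M; h x = c; h y = c\<rbrakk> \<Longrightarrow> h (f x y) = c \<and> h (g x y) = c"
  shows "h c = c"
proof -
  have closed: "closedin T M" and sub: "subalgebra (topspace T) f g M"
    and min: "\<And>N. \<lbrakk>N \<subseteq> M; closedin T N; subalgebra (topspace T) f g N\<rbrakk> \<Longrightarrow> N = M"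
    using M by (auto simp: minimal_closed_subalgebra_def)
  have cT: "c \<in> topspace T"
    using c closed closedin_subset by blast
  have "h ` M = M"
  proof (rule min)
    show "closedin T (h ` M)"
      using T h(1) closed continuous_imp_closed_map by (metis closed_map_def)
    show "subalgebra (topspace T) f g (h ` M)"
      using sub h(2) image by (auto simp: subalgebra_def)
  qed (rule h(2))
  then have nonempty: "{x \<in> M. h x = c} \<noteq> {}"
    using c by (metis (mono_tags, lifting) Collect_empty_eq imageE)
  have "{x \<in> M. h x = c} = M"
  proof (rule min)
    have "closedin T {x \<in> topspace T. h x \<in> {c}}"
      using h(1) T(2) cT by (metis closedin_continuous_map_preimage closedin_Hausdorff_singleton)
    then have "closedin T (M \<inter> {x \<in> topspace T. h x \<in> {c}})"
      using closed by (rule closedin_Int[rotated])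
    also have "M \<inter> {x \<in> topspace T. h x \<in> {c}} = {x \<in> M. h x = c}"
      using closedin_subset[OF closed] by auto
    finally show "closedin T {x \<in> M. h x = c}" .
    show "subalgebra (topspace T) f g {x \<in> M. h x = c}"
      using sub nonempty fibre by (auto simp: subalgebra_def)
  qed auto
  then show ?thesis
    using c by blast
qed

text \<open>
  A semigroup is treated as an algebra whose two operations coincide.
\<close>

lemma ellis_idempotent:
  assumes T: "compact_space T" "Hausdorff_space T"
    and S: "closedin T S" "subalgebra (topspace T) f f S"
    and assoc: "\<And>x y z. \<lbrakk>x \<in> S; y \<in> S; z \<in> S\<rbrakk> \<Longrightarrow> f (f x y) z = f x (f y z)"
    and cont: "\<And>a. a \<in> S \<Longrightarrow> continuous_map T T (f a)"
  shows "\<exists>a\<in>S. f a a = a"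
proof -
  obtain M where MS: "M \<subseteq> S" and M: "minimal_closed_subalgebra T f f M"
    using exists_minimal_closed_subalgebra[OF T(1) S] .
  have ne: "M \<noteq> {}" and cl: "\<And>x y. \<lbrakk>x \<in> M; y \<in> M\<rbrakk> \<Longrightarrow> f x y \<in> M"
    using M by (auto simp: minimal_closed_subalgebra_def subalgebra_def)
  obtain a where a: "a \<in> M"
    using ne by blast
  have assoc': "f (f x y) z = f x (f y z)" if "x \<in> M" "y \<in> M" "z \<in> M" for x y z
    using that MS assoc by blast
  have "f a a = a"
  proof (rule minimal_fixes[OF T M, where h = "f a"])
    show "continuous_map T T (f a)"
      using a MS cont by blast
    show "f a ` M \<subseteq> M"
      using a cl by blast
    fix x y assume xy: "x \<in> M" "y \<in> M"
    have "f (f a x) (f a y) = f a (f x (f a y))"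
      using a xy cl assoc' by simp
    then show "f (f a x) (f a y) \<in> f a ` M \<and> f (f a x) (f a y) \<in> f a ` M"
      using a xy cl by blast
    assume "f a x = a" "f a y = a"
    then show "f a (f x y) = a \<and> f a (f x y) = a"
      using a xy assoc' by metis
  qed (rule a)
  then show ?thesis
    using a MS by blast
qed

theorem mainTheorem1:
  fixes T :: "'a topology"
    and add mul :: "'a \<Rightarrow> 'a \<Rightarrow> 'a"
  assumes "left_topological_left_semiring T add mul"
    and "compact_space T"
    and "Hausdorff_space T"
    and "topspace T \<noteq> {}"
  shows "(\<exists>e\<in>topspace T. add e e = e \<and> mul e e = e) \<and>
         (minimal_compact T add mul \<longrightarrow> (\<exists>e. topspace T = {e}))"
proof -
  interpret left_topological_left_semiring T add mul
    by (rule assms(1))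
  have "subalgebra (topspace T) add mul (topspace T)"
    using assms(4) add_closed mul_closed by (auto simp: subalgebra_def)
  then obtain M where M: "minimal_closed_subalgebra T add mul M"
    using exists_minimal_closed_subalgebra[OF assms(2) closedin_topspace] by metis
  have MT: "M \<subseteq> topspace T" and closed: "closedin T M"
    and sub: "subalgebra (topspace T) add mul M"
    using M by (auto simp: minimal_closed_subalgebra_def subalgebra_def)
  have add_M: "add x y \<in> M" and mul_M: "mul x y \<in> M" if "x \<in> M" "y \<in> M" for x y
    using sub that by (auto simp: subalgebra_def)
  have "\<exists>a\<in>M. add a a = a"
  proof (rule ellis_idempotent[OF assms(2,3) closed, where f = add])
    show "subalgebra (topspace T) add add M"
      using sub by (auto simp: subalgebra_def)
    show "add (add x y) z = add x (add y z)" if "x \<in> M" "y \<in> M" "z \<in> M" for x y z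
      using that MT by (auto intro!: add_assoc)
    show "continuous_map T T (add b)" if "b \<in> M" for b
      using that MT by (auto intro!: continuous_add_left)
  qed
  then obtain a where a: "a \<in> M" and idem: "add a a = a"
    by blast
  have assoc: "mul (mul x y) z = mul x (mul y z)"
    and distrib: "mul x (add y z) = add (mul x y) (mul x z)"
    if "x \<in> M" "y \<in> M" "z \<in> M" for x y z
    using that MT by (auto intro!: mul_assoc left_distrib)
  have "mul a a = a"
  proof (rule minimal_fixes[OF assms(2,3) M, where h = "mul a"])
    show "continuous_map T T (mul a)"
      using a MT continuous_mul_left by blast
    show "mul a ` M \<subseteq> M"
      using a mul_M by blast
    fix x y assume xy: "x \<in> M" "y \<in> M"
    have "add (mul a x) (mul a y) = mul a (add x y)"
      using a xy distrib by simp
    moreover have "mul (mul a x) (mul a y) = mul a (mul x (mul a y))"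
      using a xy mul_M assoc by simp
    ultimately show "add (mul a x) (mul a y) \<in> mul a ` M \<and> mul (mul a x) (mul a y) \<in> mul a ` M"
      using a xy add_M mul_M by simp
    assume eq: "mul a x = a" "mul a y = a"
    have "mul a (add x y) = a"
      using a xy eq idem distrib by simp
    moreover have "mul a (mul x y) = a"
      using a xy eq assoc by metis
    ultimately show "mul a (add x y) = a \<and> mul a (mul x y) = a" ..
  qed (rule a)
  then have e: "a \<in> topspace T" "add a a = a" "mul a a = a"
    using a MT idem by auto
  have "topspace T = {a}" if "minimal_compact T add mul"
  proof -
    have "subalgebra (topspace T) add mul {a}" "compactin T {a}"
      using e by (auto simp: subalgebra_def)
    then show ?thesis
      using that unfolding minimal_compact_def by metis
  qed
  then show ?thesis
    using e by blast
qed

end
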